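(* Let $k,n$ be integers with $0<2k\leq n$. Then $\mathrm{cat}_{X_{n,k}}\mathrm{Sp}(k)=0$.
   Context: $\mathbb{H}$ denotes the quaternions, $M^*$ the conjugate transpose of a quaternionic matrix $M$. $\mathrm{Sp}(k)$ is the Lie group of matrices $P\in\mathbb{H}^{k\times k}$ with $PP^*=I_k$. For $0<k\leq n$, the quaternionic Stiefel manifold $X_{n,k}$ is the space of matrices $x\in\mathbb{H}^{n\times k}$ with $x^*x=I_k$. The group $\mathrm{Sp}(k)$ is regarded as a subspace of $X_{n,k}$ via the canonical inclusion $\iota_{n,k}\colon \mathrm{Sp}(k)\to X_{n,k}$, $P\mapsto\begin{bmatrix}0\\ P\end{bmatrix}$ (with $0\in\mathbb{H}^{(n-k)\times k}$). For a subspace $A$ of a topological space $X$, the subspace LS-category $\mathrm{cat}_X A$ is the least integer $m\geq 0$ such that there exist $m+1$ open subsets of $X$ whose union contains $A$ and each of which is contractible in $X$ (i.e. its inclusion in $X$ is homotopic to a constant map). *)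

theory Defs
  imports
    "HOL-Analysis.Analysis"
    "HOL-Library.Extended_Nat"
    "Jordan_Normal_Form.Matrix"
begin

section \<open>Quaternions\<close>

datatype quat = Quat (qRe: real) (qI: real) (qJ: real) (qK: real)

lemma quat_eq_iff: "x = y \<longleftrightarrow> qRe x = qRe y \<and> qI x = qI y \<and> qJ x = qJ y \<and> qK x = qK y"
  by (cases x; cases y) simp

instantiation quat :: ring_1
begin

definition "0 = Quat 0 0 0 0"
definition "1 = Quat 1 0 0 0"
definition "x + y = Quat (qRe x + qRe y) (qI x + qI y) (qJ x + qJ y) (qK x + qK y)"
definition "x - y = Quat (qRe x - qRe y) (qI x - qI y) (qJ x - qJ y) (qK x - qK y)"
definition "- x = Quat (- qRe x) (- qI x) (- qJ x) (- qK x)"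
definition "x * y = Quat
  (qRe x * qRe y - qI x * qI y - qJ x * qJ y - qK x * qK y)
  (qRe x * qI y + qI x * qRe y + qJ x * qK y - qK x * qJ y)
  (qRe x * qJ y - qI x * qK y + qJ x * qRe y + qK x * qI y)
  (qRe x * qK y + qI x * qJ y - qJ x * qI y + qK x * qRe y)"

lemma quat_sel [simp]:
  "qRe 0 = 0" "qI 0 = 0" "qJ 0 = 0" "qK 0 = 0"
  "qRe 1 = 1" "qI 1 = 0" "qJ 1 = 0" "qK 1 = 0"
  "qRe (x + y) = qRe x + qRe y" "qI (x + y) = qI x + qI y"
  "qJ (x + y) = qJ x + qJ y" "qK (x + y) = qK x + qK y"
  "qRe (x - y) = qRe x - qRe y" "qI (x - y) = qI x - qI y"
  "qJ (x - y) = qJ x - qJ y" "qK (x - y) = qK x - qK y"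
  "qRe (- x) = - qRe x" "qI (- x) = - qI x" "qJ (- x) = - qJ x" "qK (- x) = - qK x"
  "qRe (x * y) = qRe x * qRe y - qI x * qI y - qJ x * qJ y - qK x * qK y"
  "qI (x * y) = qRe x * qI y + qI x * qRe y + qJ x * qK y - qK x * qJ y"
  "qJ (x * y) = qRe x * qJ y - qI x * qK y + qJ x * qRe y + qK x * qI y"
  "qK (x * y) = qRe x * qK y + qI x * qJ y - qJ x * qI y + qK x * qRe y"
  by (simp_all add: zero_quat_def one_quat_def plus_quat_def minus_quat_def
      uminus_quat_def times_quat_def)

instance
  by standard (simp_all add: quat_eq_iff algebra_simps)

end

instantiation quat :: real_vector
begin

definition "scaleR r x = Quat (r * qRe x) (r * qI x) (r * qJ x) (r * qK x)"

lemma quat_sel_scaleR [simp]: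
  "qRe (r *\<^sub>R x) = r * qRe x" "qI (r *\<^sub>R x) = r * qI x"
  "qJ (r *\<^sub>R x) = r * qJ x" "qK (r *\<^sub>R x) = r * qK x"
  by (simp_all add: scaleR_quat_def)

instance
  by standard (simp_all add: quat_eq_iff algebra_simps)

end

instantiation quat :: real_inner
begin

definition "inner x y = qRe x * qRe y + qI x * qI y + qJ x * qJ y + qK x * qK y"
definition "norm x = sqrt (inner x (x :: quat))"
definition "sgn x = x /\<^sub>R norm (x :: quat)"
definition "dist x y = norm (x - y :: quat)"
definition [code del]:
  "(uniformity :: (quat \<times> quat) filter) = (INF e\<in>{0<..}. principal {(x, y). dist x y < e})"
definition [code del]:
  "open (U :: quat set) \<longleftrightarrow> (\<forall>x\<in>U. \<forall>\<^sub>F (x', y) in uniformity. x' = x \<longrightarrow> y \<in> U)"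

instance
proof
  fix x y z :: quat and r :: real
  show "inner x y = inner y x" "inner (x + y) z = inner x z + inner y z"
    "inner (r *\<^sub>R x) y = r * inner x y" "0 \<le> inner x x"
    by (simp_all add: inner_quat_def algebra_simps)
  show "inner x x = 0 \<longleftrightarrow> x = 0"
  proof
    assume "inner x x = 0"
    then have h: "(qRe x)\<^sup>2 + (qI x)\<^sup>2 + (qJ x)\<^sup>2 + (qK x)\<^sup>2 = 0"
      by (simp add: inner_quat_def power2_eq_square)
    have "0 \<le> (qRe x)\<^sup>2" "0 \<le> (qI x)\<^sup>2" "0 \<le> (qJ x)\<^sup>2" "0 \<le> (qK x)\<^sup>2"
      by simp_all
    with h have "(qRe x)\<^sup>2 = 0" "(qI x)\<^sup>2 = 0" "(qJ x)\<^sup>2 = 0" "(qK x)\<^sup>2 = 0"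
      by linarith+
    then show "x = 0"
      by (simp add: quat_eq_iff)
  qed (simp add: inner_quat_def)
qed (simp_all only: norm_quat_def sgn_quat_def dist_quat_def uniformity_quat_def open_quat_def)

end

definition qcnj :: "quat \<Rightarrow> quat" where
  "qcnj x = Quat (qRe x) (- qI x) (- qJ x) (- qK x)"

lemma qcnj_sel [simp]:
  "qRe (qcnj x) = qRe x" "qI (qcnj x) = - qI x" "qJ (qcnj x) = - qJ x" "qK (qcnj x) = - qK x"
  by (simp_all add: qcnj_def)

lemma quat_norm_sq: "(norm x)\<^sup>2 = (qRe x)\<^sup>2 + (qI x)\<^sup>2 + (qJ x)\<^sup>2 + (qK x)\<^sup>2"
  by (simp add: norm_quat_def inner_quat_def power2_eq_square)

lemma quat_mult_qcnj: "x * qcnj x = (norm x)\<^sup>2 *\<^sub>R 1" "qcnj x * x = (norm x)\<^sup>2 *\<^sub>R 1"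
  unfolding quat_norm_sq by (simp_all add: quat_eq_iff power2_eq_square algebra_simps)

instantiation quat :: real_normed_div_algebra
begin

definition "inverse x = qcnj x /\<^sub>R (norm x)\<^sup>2"
definition "x div y = x * inverse (y :: quat)"

instance
proof
  fix x y :: quat and r :: real
  show "r *\<^sub>R x * y = r *\<^sub>R (x * y)" "x * r *\<^sub>R y = r *\<^sub>R (x * y)"
    by (simp_all add: quat_eq_iff algebra_simps)
  then have scale: "\<And>(a :: quat) b (c :: real). c *\<^sub>R a * b = c *\<^sub>R (a * b)"
    "\<And>(a :: quat) b (c :: real). a * c *\<^sub>R b = c *\<^sub>R (a * b)"
    by (simp_all add: quat_eq_iff algebra_simps)
  show "inverse x * x = 1" "x * inverse x = 1" if "x \<noteq> 0"
    using that by (simp_all add: inverse_quat_def scale quat_mult_qcnj)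
  show "x div y = x * inverse y"
    by (rule divide_quat_def)
  show "inverse (0 :: quat) = 0"
    by (simp add: inverse_quat_def quat_eq_iff)
  have "(norm (x * y))\<^sup>2 = (norm x * norm y)\<^sup>2"
    unfolding power_mult_distrib quat_norm_sq by (simp add: power2_eq_square algebra_simps)
  then show "norm (x * y) = norm x * norm y"
    by (simp add: power2_eq_iff_nonneg)
qed

end


section \<open>Quaternionic matrices\<close>

definition conj_transpose :: "quat mat \<Rightarrow> quat mat" where
  "conj_transpose M = map_mat qcnj (transpose_mat M)"

text \<open>The Euclidean topology on \<open>n \<times> k\<close> matrices, that is, the product topology on the entries.\<close>

definition mat_topology :: "nat \<Rightarrow> nat \<Rightarrow> quat mat topology" where
  "mat_topology n k = pullback_topology (carrier_mat n k)
     (\<lambda>M. restrict (\<lambda>ij. M $$ ij) ({..<n} \<times> {..<k}))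
     (product_topology (\<lambda>_. euclidean) ({..<n} \<times> {..<k}))"

definition Sp :: "nat \<Rightarrow> quat mat set" where
  "Sp k = {P \<in> carrier_mat k k. P * conj_transpose P = 1\<^sub>m k}"

definition Stiefel :: "nat \<Rightarrow> nat \<Rightarrow> quat mat topology" where
  "Stiefel n k = subtopology (mat_topology n k)
     {x \<in> carrier_mat n k. conj_transpose x * x = 1\<^sub>m k}"

definition Sp_incl :: "nat \<Rightarrow> nat \<Rightarrow> quat mat \<Rightarrow> quat mat" where
  "Sp_incl n k P = 0\<^sub>m (n - k) k @\<^sub>r P"


section \<open>Subspace LS-category\<close>

definition contractible_in :: "'a topology \<Rightarrow> 'a set \<Rightarrow> bool" where
  "contractible_in X U \<longleftrightarrow> (\<exists>c. homotopic_with (\<lambda>_. True) (subtopology X U) X (\<lambda>x. x) (\<lambda>_. c))"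

text \<open>The category is \<open>\<infinity>\<close> (the infimum of the empty set) if no finite cover exists.\<close>

definition LS_cat :: "'a topology \<Rightarrow> 'a set \<Rightarrow> enat" where
  "LS_cat X A = Inf {enat m | m. \<exists>U :: nat \<Rightarrow> 'a set.
     (\<forall>i\<le>m. openin X (U i) \<and> contractible_in X (U i)) \<and> A \<subseteq> (\<Union>i\<le>m. U i)}"

end

theory Submission
  imports Defs
begin

text \<open>
  A single open set suffices. Write a point of the Stiefel manifold as a matrix \<open>x\<close> with
  orthonormal columns, consisting of an upper block \<open>A\<close> with \<open>n - k\<close> rows and a lower block \<open>B\<close>
  with \<open>k\<close> rows. The symplectic group is the locus \<open>A = 0\<close>, and the open set is the neighbourhood
  on which the squared Frobenius norm of \<open>A\<close> is less than \<open>1\<close>.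

  On it \<open>B\<close> has trivial kernel: \<open>x\<close> preserves norms, while \<open>A\<close> strictly shrinks every nonzero
  vector, so \<open>B y = 0\<close> forces \<open>y = 0\<close> (lemma \<open>combination_zero_of_lower_rows\<close>). Let \<open>c\<close> be the
  matrix whose columns are the first \<open>k\<close> standard vectors. As \<open>2 * k \<le> n\<close>, the nonzero rows of
  \<open>c\<close> all lie in the upper block, so the lower block of \<open>(1 - t) x + t c\<close> is \<open>(1 - t) B\<close>. Hence
  the whole segment from \<open>x\<close> to \<open>c\<close> consists of matrices with independent columns
  (\<open>right_independent_segment\<close>). Gram--Schmidt orthonormalization is continuous on independent
  frames, takes values in orthonormal frames and fixes those, so applying it to the segment
  contracts the neighbourhood to the point \<open>c\<close> inside the Stiefel manifold.

  One algebraic point remains. The group is defined by \<open>P P\<^sup>* = 1\<close> but the Stiefel manifold by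
  \<open>x\<^sup>* x = 1\<close>, and determinants are of no use over the quaternions; a trace argument
  (\<open>Sp_columns_orthonormal\<close>) turns one condition into the other.
\<close>

section \<open>Quaternionic column vectors\<close>

lemma qcnj_mult: "qcnj (x * y) = qcnj y * qcnj x"
  by (simp add: quat_eq_iff algebra_simps)

lemma qcnj_add: "qcnj (x + y) = qcnj x + qcnj y"
  by (simp add: quat_eq_iff)

lemma qcnj_0 [simp]: "qcnj 0 = 0" and qcnj_1 [simp]: "qcnj 1 = 1"
  by (simp_all add: quat_eq_iff)

lemma qcnj_qcnj [simp]: "qcnj (qcnj x) = x"
  by (simp add: quat_eq_iff)

lemma qcnj_scaleR: "qcnj (r *\<^sub>R x) = r *\<^sub>R qcnj x"
  by (simp add: quat_eq_iff)

lemma qcnj_sum: "qcnj (sum f A) = (\<Sum>i\<in>A. qcnj (f i))"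
  by (induction A rule: infinite_finite_induct) (simp_all add: qcnj_add)

lemma norm_qcnj [simp]: "norm (qcnj x) = norm x"
  by (simp add: norm_quat_def inner_quat_def)

lemma qRe_sum: "qRe (sum f A) = (\<Sum>i\<in>A. qRe (f i))"
  by (induction A rule: infinite_finite_induct) simp_all

text \<open>The real part is what makes a trace argument possible over a noncommutative division ring.\<close>

lemma qRe_mult_commute: "qRe (x * y) = qRe (y * x)"
  by (simp add: algebra_simps)

lemma qRe_mult_qcnj: "qRe (x * qcnj x) = (norm x)\<^sup>2"
  by (simp add: quat_mult_qcnj)

text \<open>
  Vectors of \<open>H\<^sup>n\<close> are functions on \<open>nat\<close> whose values from \<open>n\<close> on are ignored, and a frame
  \<open>v\<close> lists vectors, \<open>v j i\<close> being the \<open>i\<close>-th entry of the \<open>j\<close>-th vector. Scalars act on the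
  right, so that the form below, conjugate in its first argument, is linear in the second.\<close>

definition herm :: "nat \<Rightarrow> (nat \<Rightarrow> quat) \<Rightarrow> (nat \<Rightarrow> quat) \<Rightarrow> quat" where
  "herm n u v = (\<Sum>i<n. qcnj (u i) * v i)"

definition vnorm :: "nat \<Rightarrow> (nat \<Rightarrow> quat) \<Rightarrow> real" where
  "vnorm n u = L2_set (\<lambda>i. norm (u i)) {..<n}"

definition orthonormal :: "nat \<Rightarrow> nat \<Rightarrow> (nat \<Rightarrow> nat \<Rightarrow> quat) \<Rightarrow> bool" where
  "orthonormal n k v \<longleftrightarrow> (\<forall>a<k. \<forall>b<k. herm n (v a) (v b) = (if a = b then 1 else 0))"

definition right_independent :: "nat \<Rightarrow> nat \<Rightarrow> (nat \<Rightarrow> nat \<Rightarrow> quat) \<Rightarrow> bool" where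
  "right_independent n k v \<longleftrightarrow>
     (\<forall>y. (\<forall>i<n. (\<Sum>j<k. v j i * y j) = 0) \<longrightarrow> (\<forall>j<k. y j = 0))"

lemma herm_commute: "herm n u v = qcnj (herm n v u)"
  by (simp add: herm_def qcnj_sum qcnj_mult)

lemma herm_diff_right: "herm n u (\<lambda>i. v i - w i) = herm n u v - herm n u w"
  by (simp add: herm_def algebra_simps sum_subtractf)

lemma herm_scaleR_right: "herm n u (\<lambda>i. r *\<^sub>R v i) = r *\<^sub>R herm n u v"
  by (simp add: herm_def scaleR_sum_right)

lemma herm_scaleR_left: "herm n (\<lambda>i. r *\<^sub>R u i) v = r *\<^sub>R herm n u v"
  by (simp add: herm_def scaleR_sum_right qcnj_scaleR)

lemma herm_sum_right: "herm n u (\<lambda>i. \<Sum>l\<in>A. v l i * c l) = (\<Sum>l\<in>A. herm n u (v l) * c l)"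
  unfolding herm_def sum_distrib_left sum_distrib_right
  by (subst sum.swap) (simp add: mult.assoc)

lemma herm_self: "herm n u u = (vnorm n u)\<^sup>2 *\<^sub>R 1"
  by (simp add: herm_def vnorm_def L2_set_def sum_nonneg quat_mult_qcnj scaleR_sum_left)

lemma vnorm_eq_0: "vnorm n u = 0 \<longleftrightarrow> (\<forall>i<n. u i = 0)"
  unfolding vnorm_def by (subst L2_set_eq_0_iff) auto

section \<open>Gram--Schmidt orthonormalization\<close>

text \<open>
  The recursion is on the position \<open>j\<close> in the frame. If the residual \<open>w\<close> vanishes then the value is
  \<open>0\<close>, since \<open>inverse 0 = 0\<close>; for independent frames this does not occur.\<close>

fun gram_schmidt :: "nat \<Rightarrow> (nat \<Rightarrow> nat \<Rightarrow> quat) \<Rightarrow> nat \<Rightarrow> nat \<Rightarrow> quat" where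
  "gram_schmidt n v j =
     (let w = (\<lambda>i. v j i - (\<Sum>l<j. gram_schmidt n v l i * herm n (gram_schmidt n v l) (v j)))
      in (\<lambda>i. inverse (vnorm n w) *\<^sub>R w i))"

declare gram_schmidt.simps [simp del]

definition gs_residual :: "nat \<Rightarrow> (nat \<Rightarrow> nat \<Rightarrow> quat) \<Rightarrow> nat \<Rightarrow> nat \<Rightarrow> quat" where
  "gs_residual n v j i =
     v j i - (\<Sum>l<j. gram_schmidt n v l i * herm n (gram_schmidt n v l) (v j))"

lemma gram_schmidt_eq:
  "gram_schmidt n v j = (\<lambda>i. inverse (vnorm n (gs_residual n v j)) *\<^sub>R gs_residual n v j i)"
  by (subst gram_schmidt.simps) (simp add: Let_def gs_residual_def[abs_def])

text \<open>
  Equality of the entries is required at every index, also from \<open>n\<close> on. Gram--Schmidt combines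
  whole functions, so this holds and keeps \<open>n\<close> out of the notion of span.\<close>

definition right_span :: "nat \<Rightarrow> (nat \<Rightarrow> nat \<Rightarrow> quat) \<Rightarrow> (nat \<Rightarrow> quat) set" where
  "right_span m v = {u. \<exists>c. u = (\<lambda>i. \<Sum>l<m. v l i * c l)}"

lemma right_spanI: "(\<And>i. u i = (\<Sum>l<m. v l i * c l)) \<Longrightarrow> u \<in> right_span m v"
  unfolding right_span_def by blast

lemma right_span_mono:
  assumes "u \<in> right_span m v" "m \<le> m'"
  shows "u \<in> right_span m' v"
proof -
  obtain c where u: "u = (\<lambda>i. \<Sum>l<m. v l i * c l)"
    using assms unfolding right_span_def by auto
  have "u i = (\<Sum>l<m'. v l i * (if l < m then c l else 0))" for i
    unfolding u using assms(2) by (intro sum.mono_neutral_cong_left) auto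
  then show ?thesis by (rule right_spanI)
qed

lemma right_span_mult:
  assumes "u \<in> right_span m v"
  shows "(\<lambda>i. u i * q) \<in> right_span m v"
proof -
  obtain c where "u = (\<lambda>i. \<Sum>l<m. v l i * c l)"
    using assms unfolding right_span_def by auto
  then have "u i * q = (\<Sum>l<m. v l i * (c l * q))" for i
    by (simp add: sum_distrib_right mult.assoc)
  then show ?thesis by (rule right_spanI)
qed

lemma right_span_diff:
  assumes "u \<in> right_span m v" "w \<in> right_span m v"
  shows "(\<lambda>i. u i - w i) \<in> right_span m v"
proof -
  obtain c d where "u = (\<lambda>i. \<Sum>l<m. v l i * c l)" "w = (\<lambda>i. \<Sum>l<m. v l i * d l)"
    using assms unfolding right_span_def by auto
  then have "u i - w i = (\<Sum>l<m. v l i * (c l - d l))" for i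
    by (simp add: sum_subtractf algebra_simps)
  then show ?thesis by (rule right_spanI)
qed

lemma right_span_sum:
  assumes "\<And>l. l < p \<Longrightarrow> u l \<in> right_span m v"
  shows "(\<lambda>i. \<Sum>l<p. u l i) \<in> right_span m v"
proof -
  have "\<forall>l. \<exists>c. l < p \<longrightarrow> u l = (\<lambda>i. \<Sum>j<m. v j i * c j)"
    using assms unfolding right_span_def by auto
  then obtain c where c: "\<And>l. l < p \<Longrightarrow> u l = (\<lambda>i. \<Sum>j<m. v j i * c l j)"
    by metis
  have "(\<Sum>l<p. u l i) = (\<Sum>j<m. v j i * (\<Sum>l<p. c l j))" for i
  proof -
    have "(\<Sum>l<p. u l i) = (\<Sum>l<p. \<Sum>j<m. v j i * c l j)"
      by (intro sum.cong) (auto simp: c)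
    then show ?thesis by (subst (asm) sum.swap) (simp add: sum_distrib_left)
  qed
  then show ?thesis by (rule right_spanI)
qed

lemma right_span_self:
  assumes "j < m" shows "v j \<in> right_span m v"
proof -
  have "v j i = (\<Sum>l<m. v l i * (if l = j then 1 else 0))" for i
    using assms by (simp add: if_distrib cong: if_cong)
  then show ?thesis by (rule right_spanI)
qed

lemma gs_correction_in_span:
  assumes "\<And>l. l < j \<Longrightarrow> gram_schmidt n v l \<in> right_span (Suc l) v"
  shows "(\<lambda>i. \<Sum>l<j. gram_schmidt n v l i * herm n (gram_schmidt n v l) (v j)) \<in> right_span j v"
  by (intro right_span_sum right_span_mult right_span_mono[OF assms]) auto

lemma gram_schmidt_in_span: "gram_schmidt n v j \<in> right_span (Suc j) v"
proof (induction j rule: less_induct)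
  case (less j)
  have "gs_residual n v j \<in> right_span (Suc j) v"
    unfolding gs_residual_def[abs_def]
    by (intro right_span_diff right_span_self right_span_mono[OF gs_correction_in_span] less) auto
  from right_span_mult[OF this, of "inverse (vnorm n (gs_residual n v j)) *\<^sub>R 1"]
  show ?case by (simp add: gram_schmidt_eq)
qed

text \<open>
  The residual is the \<open>j\<close>-th vector minus a combination of the earlier ones. It is thus a
  combination of the frame with coefficient \<open>1\<close> at \<open>j\<close>, and independence forbids that it vanishes.\<close>

lemma gs_residual_nonzero:
  assumes ind: "right_independent n k v" and j: "j < k"
  shows "vnorm n (gs_residual n v j) \<noteq> 0"
proof
  assume "vnorm n (gs_residual n v j) = 0"
  then have zero: "gs_residual n v j i = 0" if "i < n" for i
    using that by (simp add: vnorm_eq_0)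
  obtain c where c: "\<And>i. (\<Sum>l<j. gram_schmidt n v l i * herm n (gram_schmidt n v l) (v j))
      = (\<Sum>l<j. v l i * c l)"
    using gs_correction_in_span[OF gram_schmidt_in_span, where j=j and v=v and n=n]
    unfolding right_span_def by (auto simp: fun_eq_iff)
  define y where "y l = (if l < j then - c l else if l = j then 1 else 0)" for l
  have "(\<Sum>l<k. v l i * y l) = gs_residual n v j i" for i
  proof -
    have "(\<Sum>l<k. v l i * y l) = (\<Sum>l<Suc j. v l i * y l)"
      using j by (intro sum.mono_neutral_right) (auto simp: y_def)
    also have "\<dots> = gs_residual n v j i"
      by (simp add: gs_residual_def c y_def sum_negf)
    finally show ?thesis .
  qed
  with zero ind j have "y j = 0" unfolding right_independent_def by metis
  then show False by (simp add: y_def)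
qed

lemma herm_gs_residual:
  assumes orth: "orthonormal n j (gram_schmidt n v)" and a: "a < j"
  shows "herm n (gram_schmidt n v a) (gs_residual n v j) = 0"
proof -
  let ?g = "gram_schmidt n v"
  have "(\<Sum>l<j. herm n (?g a) (?g l) * herm n (?g l) (v j))
      = (\<Sum>l<j. if l = a then herm n (?g a) (v j) else 0)"
    using orth a unfolding orthonormal_def by (intro sum.cong) auto
  with a show ?thesis
    by (simp add: gs_residual_def[abs_def] herm_diff_right herm_sum_right)
qed

lemma orthonormal_gram_schmidt:
  assumes "right_independent n k v"
  shows "orthonormal n k (gram_schmidt n v)"
proof -
  let ?g = "gram_schmidt n v"
  have "orthonormal n j ?g" if "j \<le> k" for j
    using that
  proof (induction j)
    case 0
    then show ?case by (simp add: orthonormal_def)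
  next
    case (Suc j)
    then have orth: "orthonormal n j ?g" by simp
    have nz: "vnorm n (gs_residual n v j) \<noteq> 0"
      using gs_residual_nonzero[OF assms] Suc.prems by simp
    have left: "herm n (?g a) (?g j) = 0" if "a < j" for a
      by (subst (2) gram_schmidt_eq) (simp add: herm_scaleR_right herm_gs_residual[OF orth that])
    have right: "herm n (?g j) (?g a) = 0" if "a < j" for a
      by (subst herm_commute) (simp add: left[OF that])
    have self: "herm n (?g j) (?g j) = 1"
      using nz by (simp add: gram_schmidt_eq[of n v j] herm_scaleR_left herm_scaleR_right
          herm_self power2_eq_square field_simps)
    show ?case
      using orth left right self unfolding orthonormal_def by (auto simp: less_Suc_eq)
  qed
  then show ?thesis by simp
qed

text \<open>
  An orthonormal frame needs no correction and no rescaling. This makes the homotopy start at the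
  identity.\<close>

lemma gram_schmidt_orthonormal:
  assumes "orthonormal n k v" and "j < k"
  shows "gram_schmidt n v j = v j"
  using assms(2)
proof (induction j rule: less_induct)
  case (less j)
  have "gs_residual n v j = v j"
  proof
    fix i
    have "(\<Sum>l<j. gram_schmidt n v l i * herm n (gram_schmidt n v l) (v j)) = 0"
      using assms(1) less unfolding orthonormal_def by (intro sum.neutral) auto
    then show "gs_residual n v j i = v j i" by (simp add: gs_residual_def)
  qed
  moreover have "vnorm n (v j) = 1"
  proof -
    have "(vnorm n (v j))\<^sup>2 *\<^sub>R (1::quat) = 1"
      using assms(1) less.prems by (simp add: orthonormal_def flip: herm_self)
    then have "(vnorm n (v j))\<^sup>2 = 1" by (simp add: quat_eq_iff)
    moreover have "vnorm n (v j) \<ge> 0" by (simp add: vnorm_def L2_set_nonneg)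
    ultimately show ?thesis by (simp add: power2_eq_1_iff)
  qed
  ultimately show ?case by (simp add: gram_schmidt_eq)
qed

section \<open>Continuity of orthonormalization\<close>

lemma continuous_map_euclidean_compose:
  assumes "continuous_map X euclidean f" "continuous_on UNIV h"
  shows "continuous_map X euclidean (\<lambda>x. h (f x))"
  using continuous_map_compose[OF assms(1), of euclidean h] assms(2) by (simp add: o_def)

lemma continuous_map_qcnj [continuous_intros]:
  assumes "continuous_map X euclidean f"
  shows "continuous_map X euclidean (\<lambda>x. qcnj (f x))"
proof (rule continuous_map_euclidean_compose[OF assms])
  have "bounded_linear qcnj"
    by (rule bounded_linear_intro[where K = 1]) (simp_all add: qcnj_add qcnj_scaleR)
  then show "continuous_on UNIV qcnj" by (rule linear_continuous_on)
qed

lemma continuous_map_quat_mult [continuous_intros]: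
  fixes f g :: "'a \<Rightarrow> quat"
  assumes "continuous_map X euclidean f" "continuous_map X euclidean g"
  shows "continuous_map X euclidean (\<lambda>x. f x * g x)"
  using assms by (simp add: continuous_map_atin tendsto_mult)

lemma continuous_map_quat_scaleR [continuous_intros]:
  fixes g :: "'a \<Rightarrow> quat"
  assumes "continuous_map X euclidean f" "continuous_map X euclidean g"
  shows "continuous_map X euclidean (\<lambda>x. f x *\<^sub>R g x)"
  using assms by (simp add: continuous_map_atin tendsto_scaleR)

lemma continuous_map_herm:
  assumes "\<And>i. i < n \<Longrightarrow> continuous_map X euclidean (\<lambda>x. u x i)"
    and "\<And>i. i < n \<Longrightarrow> continuous_map X euclidean (\<lambda>x. v x i)"
  shows "continuous_map X euclidean (\<lambda>x. herm n (u x) (v x))"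
  unfolding herm_def by (intro continuous_intros assms) auto

lemma continuous_map_vnorm:
  assumes "\<And>i. i < n \<Longrightarrow> continuous_map X euclidean (\<lambda>x. u x i)"
  shows "continuous_map X euclidean (\<lambda>x. vnorm n (u x))"
  unfolding vnorm_def L2_set_def
  by (rule continuous_map_euclidean_compose[where h = sqrt])
     (intro continuous_intros assms; auto)+

text \<open>
  Independence enters because it keeps the norms that are inverted away from \<open>0\<close>.\<close>

lemma continuous_map_gram_schmidt:
  assumes cont: "\<And>i j. i < n \<Longrightarrow> j < k \<Longrightarrow> continuous_map X euclidean (\<lambda>x. v x j i)"
    and ind: "\<And>x. x \<in> topspace X \<Longrightarrow> right_independent n k (v x)"
    and "j < k" "i < n"
  shows "continuous_map X euclidean (\<lambda>x. gram_schmidt n (v x) j i)"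
  using assms(3,4)
proof (induction j arbitrary: i rule: less_induct)
  case (less j)
  have res: "continuous_map X euclidean (\<lambda>x. gs_residual n (v x) j i)" if "i < n" for i
    unfolding gs_residual_def
    using that less.prems(1)
    by (intro continuous_intros continuous_map_herm less.IH cont) auto
  have "continuous_map X euclidean (\<lambda>x. inverse (vnorm n (gs_residual n (v x) j)))"
    using gs_residual_nonzero[OF ind less.prems(1)]
    by (intro continuous_map_real_inverse continuous_map_vnorm res) auto
  then show ?case
    unfolding gram_schmidt_eq by (intro continuous_map_quat_scaleR res less.prems)
qed

section \<open>The Stiefel manifold\<close>

abbreviation column_frame :: "quat mat \<Rightarrow> nat \<Rightarrow> nat \<Rightarrow> quat" where
  "column_frame M \<equiv> \<lambda>j i. M $$ (i, j)"

lemma conj_transpose_mult_entry: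
  assumes "M \<in> carrier_mat n k" "a < k" "b < k"
  shows "(conj_transpose M * M) $$ (a, b) = herm n (column_frame M a) (column_frame M b)"
  using assms by (simp add: conj_transpose_def herm_def scalar_prod_def lessThan_atLeast0)

lemma topspace_Stiefel:
  "topspace (Stiefel n k) = {M \<in> carrier_mat n k. orthonormal n k (column_frame M)}"
proof -
  have "topspace (mat_topology n k) = carrier_mat n k"
    by (auto simp: mat_topology_def topspace_pullback_topology)
  moreover have "conj_transpose M * M = 1\<^sub>m k \<longleftrightarrow> orthonormal n k (column_frame M)"
    if M: "M \<in> carrier_mat n k" for M
  proof
    assume "conj_transpose M * M = 1\<^sub>m k"
    then show "orthonormal n k (column_frame M)"
      unfolding orthonormal_def
      by (metis M conj_transpose_mult_entry index_one_mat(1))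
  next
    assume orth: "orthonormal n k (column_frame M)"
    show "conj_transpose M * M = 1\<^sub>m k"
    proof (rule eq_matI)
      fix a b assume "a < dim_row (1\<^sub>m k :: quat mat)" "b < dim_col (1\<^sub>m k :: quat mat)"
      then show "(conj_transpose M * M) $$ (a, b) = 1\<^sub>m k $$ (a, b)"
        using orth by (simp add: conj_transpose_mult_entry[OF M] orthonormal_def)
    qed (use M in \<open>auto simp: conj_transpose_def\<close>)
  qed
  ultimately show ?thesis unfolding Stiefel_def by auto
qed

lemma continuous_map_into_Stiefel:
  assumes "\<And>x. x \<in> topspace X \<Longrightarrow> f x \<in> topspace (Stiefel n k)"
    and "\<And>i j. i < n \<Longrightarrow> j < k \<Longrightarrow> continuous_map X euclidean (\<lambda>x. f x $$ (i, j))"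
  shows "continuous_map X (Stiefel n k) f"
proof -
  have "continuous_map X (mat_topology n k) f"
    unfolding mat_topology_def
  proof (rule continuous_map_pullback')
    show "continuous_map X (product_topology (\<lambda>_. euclidean) ({..<n} \<times> {..<k}))
        ((\<lambda>M. restrict (\<lambda>ij. M $$ ij) ({..<n} \<times> {..<k})) \<circ> f)"
      using assms(2) by (auto simp: continuous_map_componentwise)
    show "topspace X \<subseteq> f -` carrier_mat n k"
      using assms(1) by (auto simp: topspace_Stiefel)
  qed
  then show ?thesis
    using assms(1) unfolding Stiefel_def by (auto simp: continuous_map_in_subtopology)
qed

lemma continuous_map_Stiefel_entry:
  assumes "i < n" "j < k"
  shows "continuous_map (Stiefel n k) euclidean (\<lambda>M. M $$ (i, j))"
proof -
  have "continuous_map (mat_topology n k) euclidean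
      ((\<lambda>g. g (i, j)) \<circ> (\<lambda>M. restrict (\<lambda>ij. M $$ ij) ({..<n} \<times> {..<k})))"
    unfolding mat_topology_def
    using assms by (intro continuous_map_pullback continuous_map_product_projection) auto
  then have "continuous_map (mat_topology n k) euclidean (\<lambda>M. M $$ (i, j))"
    using assms by (simp add: o_def)
  then show ?thesis unfolding Stiefel_def by (rule continuous_map_from_subtopology)
qed

text \<open>
  Pairing the combination with \<open>v j\<close> recovers the coefficient \<open>y j\<close>, so pairing it with itself
  gives the squared norm of \<open>y\<close>.\<close>

lemma orthonormal_isometry:
  assumes "orthonormal n k v"
  shows "vnorm n (\<lambda>i. \<Sum>j<k. v j i * y j) = vnorm k y"
proof -
  let ?u = "\<lambda>i. \<Sum>j<k. v j i * y j"
  have coord: "herm n (v j) ?u = y j" if "j < k" for j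
  proof -
    have "herm n (v j) ?u = (\<Sum>l<k. if l = j then y j else 0)"
      unfolding herm_sum_right using assms that
      by (intro sum.cong) (auto simp: orthonormal_def)
    with that show ?thesis by simp
  qed
  have "herm n ?u ?u = (\<Sum>j<k. qcnj (herm n (v j) ?u) * y j)"
    unfolding herm_sum_right[of n ?u] by (simp flip: herm_commute)
  also have "\<dots> = herm k y y"
    by (simp add: coord herm_def[of k])
  finally have "(vnorm n ?u)\<^sup>2 = (vnorm k y)\<^sup>2"
    by (simp add: herm_self quat_eq_iff)
  then show ?thesis by (simp add: power2_eq_iff_nonneg vnorm_def L2_set_nonneg)
qed

definition rows_norm_sq :: "nat \<Rightarrow> nat \<Rightarrow> (nat \<Rightarrow> nat \<Rightarrow> quat) \<Rightarrow> real" where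
  "rows_norm_sq m k v = (\<Sum>i<m. \<Sum>j<k. (norm (v j i))\<^sup>2)"

text \<open>
  The operator norm is at most the Frobenius norm, by the Cauchy--Schwarz inequality in each row.
  The Frobenius norm is preferred as a measure of smallness because it is visibly continuous.\<close>

lemma vnorm_combination_le:
  "(vnorm m (\<lambda>i. \<Sum>j<k. v j i * y j))\<^sup>2 \<le> rows_norm_sq m k v * (vnorm k y)\<^sup>2"
proof -
  have sq: "(vnorm p u)\<^sup>2 = (\<Sum>i<p. (norm (u i))\<^sup>2)" for p u
    by (simp add: vnorm_def L2_set_def sum_nonneg)
  have "(norm (\<Sum>j<k. v j i * y j))\<^sup>2 \<le> (\<Sum>j<k. (norm (v j i))\<^sup>2) * (vnorm k y)\<^sup>2" for i
  proof -
    have "norm (\<Sum>j<k. v j i * y j) \<le> (\<Sum>j<k. norm (v j i) * norm (y j))"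
      by (rule order_trans[OF norm_sum]) (simp add: norm_mult)
    also have "\<dots> \<le> vnorm k (\<lambda>j. v j i) * vnorm k y"
      using L2_set_mult_ineq[of "\<lambda>j. norm (v j i)" "\<lambda>j. norm (y j)" "{..<k}"]
      by (simp add: vnorm_def)
    finally have "(norm (\<Sum>j<k. v j i * y j))\<^sup>2 \<le> (vnorm k (\<lambda>j. v j i) * vnorm k y)\<^sup>2"
      by (intro power_mono) auto
    then show ?thesis by (simp add: power_mult_distrib sq)
  qed
  then show ?thesis
    unfolding sq rows_norm_sq_def sum_distrib_right by (intro sum_mono) (simp add: sum_distrib_right)
qed

text \<open>
  A combination whose entries vanish from row \<open>m\<close> on has the norm of its first \<open>m\<close> entries. That
  norm equals the norm of \<open>y\<close> by isometry, and is strictly smaller unless \<open>y = 0\<close>.\<close>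

lemma combination_zero_of_lower_rows:
  assumes orth: "orthonormal n k v" and small: "rows_norm_sq m k v < 1" and "m \<le> n"
    and zero: "\<And>i. m \<le> i \<Longrightarrow> i < n \<Longrightarrow> (\<Sum>j<k. v j i * y j) = 0" and "j < k"
  shows "y j = 0"
proof -
  let ?u = "\<lambda>i. \<Sum>j<k. v j i * y j"
  have "(\<Sum>i<n. (norm (?u i))\<^sup>2) = (\<Sum>i<m. (norm (?u i))\<^sup>2)"
    using zero \<open>m \<le> n\<close> by (intro sum.mono_neutral_right) auto
  then have "vnorm n ?u = vnorm m ?u"
    by (simp add: vnorm_def L2_set_def)
  then have "(vnorm k y)\<^sup>2 \<le> rows_norm_sq m k v * (vnorm k y)\<^sup>2"
    using vnorm_combination_le[where m=m and k=k and v=v and y=y] orthonormal_isometry[OF orth, where y=y] by simp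
  then have "(1 - rows_norm_sq m k v) * (vnorm k y)\<^sup>2 \<le> 0"
    by (simp add: algebra_simps)
  with small have "vnorm k y = 0"
    by (simp add: mult_le_0_iff)
  with \<open>j < k\<close> show ?thesis by (simp add: vnorm_eq_0)
qed

definition std_frame :: "nat \<Rightarrow> nat \<Rightarrow> quat" where
  "std_frame j i = (if i = j then 1 else 0)"

lemma orthonormal_std_frame:
  assumes "k \<le> n" shows "orthonormal n k std_frame"
proof -
  have "herm n (std_frame a) (std_frame b) = (\<Sum>i<n. if i = b then std_frame a b else 0)" for a b
    unfolding herm_def by (intro sum.cong) (auto simp: std_frame_def)
  then show ?thesis using assms by (auto simp: orthonormal_def std_frame_def)
qed

text \<open>
  In the last \<open>k\<close> rows the standard frame vanishes, because \<open>k \<le> n - k\<close>. For \<open>t \<noteq> 1\<close> these rows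
  already determine the coefficients; at \<open>t = 1\<close> the frame is the standard one. For \<open>n < 2 * k\<close> the
  argument breaks down, since the standard frame then meets the last \<open>k\<close> rows.\<close>

lemma right_independent_segment:
  assumes orth: "orthonormal n k v" and small: "rows_norm_sq (n - k) k v < 1"
    and "2 * k \<le> n"
  shows "right_independent n k (\<lambda>j i. (1 - t) *\<^sub>R v j i + t *\<^sub>R std_frame j i)"
  unfolding right_independent_def
proof (intro allI impI)
  fix y j
  assume "\<forall>i<n. (\<Sum>j<k. ((1 - t) *\<^sub>R v j i + t *\<^sub>R std_frame j i) * y j) = 0" and j: "j < k"
  then have eq: "(1 - t) *\<^sub>R (\<Sum>j<k. v j i * y j) + t *\<^sub>R (\<Sum>j<k. std_frame j i * y j) = 0"
    if "i < n" for i
    using that by (simp add: distrib_right sum.distrib scaleR_sum_right)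
  have std: "(\<Sum>j<k. std_frame j i * y j) = (if i < k then y i else 0)" for i
  proof -
    have "(\<Sum>j<k. std_frame j i * y j) = (\<Sum>j<k. if j = i then y i else 0)"
      by (intro sum.cong) (auto simp: std_frame_def)
    then show ?thesis by simp
  qed
  show "y j = 0"
  proof (cases "t = 1")
    case True
    then show ?thesis using eq[of j] j \<open>2 * k \<le> n\<close> by (simp add: std)
  next
    case False
    show ?thesis
    proof (rule combination_zero_of_lower_rows[OF orth small _ _ j])
      fix i assume i: "n - k \<le> i" "i < n"
      then have "\<not> i < k" using \<open>2 * k \<le> n\<close> by linarith
      then show "(\<Sum>j<k. v j i * y j) = 0"
        using eq[OF i(2)] False by (simp add: std)
    qed simp
  qed
qed

lemma contractible_in_small_rows:
  assumes "2 * k \<le> n"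
  shows "contractible_in (Stiefel n k)
    {M \<in> topspace (Stiefel n k). rows_norm_sq (n - k) k (column_frame M) < 1}"
    (is "contractible_in ?X ?U")
proof -
  define v where "v t M = (\<lambda>j i. (1 - t) *\<^sub>R column_frame M j i + t *\<^sub>R std_frame j i)" for t :: real and M
  define h where "h = (\<lambda>(t, M). mat n k (\<lambda>(i, j). gram_schmidt n (v t M) j i))"
  define c where "c = mat n k (\<lambda>(i, j). std_frame j i)"
  let ?T = "prod_topology (top_of_set {0..1::real}) (subtopology ?X ?U)"
  have ind: "right_independent n k (v t M)" if "M \<in> ?U" for t M
    unfolding v_def using that assms
    by (intro right_independent_segment) (auto simp: topspace_Stiefel)
  have mat_in: "mat n k (\<lambda>(i, j). g j i) \<in> topspace ?X \<longleftrightarrow> orthonormal n k g" for g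
    by (simp add: topspace_Stiefel orthonormal_def herm_def)
  have proj: "continuous_map ?T euclidean fst"
    "continuous_map ?T ?X snd"
    using continuous_map_fst[of "top_of_set {0..1::real}" "subtopology ?X ?U"]
      continuous_map_snd[of "top_of_set {0..1::real}" "subtopology ?X ?U"]
    by (auto simp: continuous_map_in_subtopology)
  have "continuous_map ?T ?X h"
  proof (rule continuous_map_into_Stiefel)
    fix x assume "x \<in> topspace ?T"
    then have "snd x \<in> ?U" by auto
    then show "h x \<in> topspace ?X"
      by (auto simp: h_def case_prod_beta mat_in intro!: orthonormal_gram_schmidt ind)
  next
    fix i j assume ij: "i < n" "j < k"
    have "continuous_map ?T euclidean (\<lambda>x. gram_schmidt n (v (fst x) (snd x)) j i)"
    proof (rule continuous_map_gram_schmidt[OF _ _ ij(2,1)])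
      fix i j assume ij: "i < n" "j < k"
      have "continuous_map ?T euclidean (\<lambda>x. column_frame (snd x) j i)"
        using continuous_map_compose[OF proj(2) continuous_map_Stiefel_entry[OF ij]]
        by (simp add: o_def)
      then show "continuous_map ?T euclidean (\<lambda>x. v (fst x) (snd x) j i)"
        unfolding v_def using proj(1)
        by (intro continuous_intros) auto
    next
      fix x assume "x \<in> topspace ?T"
      then show "right_independent n k (v (fst x) (snd x))" by (intro ind) auto
    qed
    then show "continuous_map ?T euclidean (\<lambda>x. h x $$ (i, j))"
      using ij by (simp add: h_def case_prod_beta)
  qed
  moreover have "h (0, M) = M" if "M \<in> ?U" for M
    using that gram_schmidt_orthonormal[of n k "column_frame M"]
    by (intro eq_matI) (auto simp: h_def v_def topspace_Stiefel)
  moreover have "h (1, M) = c" for M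
  proof -
    have "orthonormal n k std_frame" using assms by (intro orthonormal_std_frame) auto
    then show ?thesis
      by (intro eq_matI) (auto simp: h_def v_def c_def gram_schmidt_orthonormal)
  qed
  ultimately have "homotopic_with (\<lambda>_. True) (subtopology ?X ?U) ?X (\<lambda>x. x) (\<lambda>_. c)"
    by (subst homotopic_with) auto
  then show ?thesis unfolding contractible_in_def by blast
qed

lemma openin_small_rows:
  assumes "m \<le> n"
  shows "openin (Stiefel n k) {M \<in> topspace (Stiefel n k). rows_norm_sq m k (column_frame M) < 1}"
proof -
  have "continuous_map (Stiefel n k) euclidean (\<lambda>M. rows_norm_sq m k (column_frame M))"
    unfolding rows_norm_sq_def using assms
    by (intro continuous_intros continuous_map_Stiefel_entry) auto
  from openin_continuous_map_preimage[OF this, of "{..<1}"] show ?thesis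
    by simp
qed

section \<open>Inclusion of the symplectic group\<close>

text \<open>
  For \<open>P P\<^sup>* = 1\<close> the matrix \<open>E = P\<^sup>* P\<close> is a Hermitian idempotent, so its squared Frobenius norm is
  the real part of its trace. Real parts of traces are invariant under cyclic permutation, so this
  value is the trace \<open>k\<close> of \<open>P P\<^sup>*\<close>. Then the squared Frobenius norm of \<open>E - 1\<close> is
  \<open>k - 2 k + k = 0\<close>.\<close>

lemma Sp_columns_orthonormal:
  assumes P: "P \<in> Sp k"
  shows "orthonormal k k (column_frame P)"
proof -
  have carrier: "P \<in> carrier_mat k k" and one: "P * conj_transpose P = 1\<^sub>m k"
    using P by (auto simp: Sp_def)
  have carrier': "conj_transpose P \<in> carrier_mat k k"
    using carrier by (simp add: conj_transpose_def)
  define e where "e a b = herm k (column_frame P a) (column_frame P b)" for a b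
  have e: "(conj_transpose P * P) $$ (a, b) = e a b" if "a < k" "b < k" for a b
    using conj_transpose_mult_entry[OF carrier that] by (simp add: e_def)
  have e_cnj: "e b a = qcnj (e a b)" for a b
    unfolding e_def by (rule herm_commute)
  have "(conj_transpose P * P) * (conj_transpose P * P) = conj_transpose P * P"
  proof -
    have "(conj_transpose P * P) * (conj_transpose P * P)
        = conj_transpose P * (P * conj_transpose P) * P"
      using carrier carrier' by (simp add: assoc_mult_mat[of _ k k _ k _ k])
    then show ?thesis using carrier' by (simp add: one)
  qed
  then have idem: "e a a = (\<Sum>b<k. e a b * e b a)" if "a < k" for a
  proof -
    have "e a a = ((conj_transpose P * P) * (conj_transpose P * P)) $$ (a, a)"
      using \<open>_ = conj_transpose P * P\<close> e that by simp
    also have "\<dots> = (\<Sum>b<k. (conj_transpose P * P) $$ (a, b) * (conj_transpose P * P) $$ (b, a))"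
      using carrier carrier' that
      by (simp add: scalar_prod_def lessThan_atLeast0 del: index_mult_mat)
         (subst index_mult_mat; simp add: scalar_prod_def)
    finally show ?thesis using that by (simp add: e)
  qed
  have norm_e: "(\<Sum>b<k. (norm (e a b))\<^sup>2) = qRe (e a a)" if "a < k" for a
    unfolding idem[OF that] qRe_sum
    by (intro sum.cong refl) (subst e_cnj, simp add: qRe_mult_qcnj del: quat_sel)
  have trace: "(\<Sum>a<k. qRe (e a a)) = real k"
  proof -
    have "(\<Sum>a<k. qRe (e a a)) = (\<Sum>i<k. \<Sum>a<k. qRe (P $$ (i, a) * qcnj (P $$ (i, a))))"
      unfolding e_def herm_def qRe_sum
      by (subst sum.swap) (subst qRe_mult_commute, rule refl)
    also have "\<dots> = (\<Sum>i<k. qRe ((P * conj_transpose P) $$ (i, i)))"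
      using carrier
      by (intro sum.cong)
         (simp_all add: conj_transpose_def scalar_prod_def lessThan_atLeast0 qRe_sum del: quat_sel)
    finally show ?thesis by (simp add: one)
  qed
  define d :: "nat \<Rightarrow> nat \<Rightarrow> quat" where "d a b = (if a = b then 1 else 0)" for a b
  have "(\<Sum>a<k. \<Sum>b<k. (norm (e a b - d a b))\<^sup>2) = 0"
  proof -
    have "(norm (e a b - d a b))\<^sup>2
        = (norm (e a b))\<^sup>2 + (if b = a then 1 - 2 * qRe (e a a) else 0)" for a b
      unfolding quat_norm_sq by (simp add: d_def power2_eq_square algebra_simps)
    then have "(\<Sum>a<k. \<Sum>b<k. (norm (e a b - d a b))\<^sup>2) = (\<Sum>a<k. 1 - qRe (e a a))"
      by (simp add: sum.distrib norm_e)
    also have "\<dots> = 0" by (simp add: sum_subtractf trace)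
    finally show ?thesis .
  qed
  then have "e a b = d a b" if "a < k" "b < k" for a b
    using that by (simp add: sum_nonneg_eq_0_iff sum_nonneg)
  then show ?thesis by (simp add: orthonormal_def e_def d_def)
qed

lemma Sp_incl_in_small_rows:
  assumes P: "P \<in> Sp k" and "k \<le> n"
  shows "Sp_incl n k P \<in> topspace (Stiefel n k)"
    and "rows_norm_sq (n - k) k (column_frame (Sp_incl n k P)) = 0"
proof -
  have carrier: "P \<in> carrier_mat k k" using P by (simp add: Sp_def)
  have "Sp_incl n k P \<in> carrier_mat (n - k + k) k"
    unfolding Sp_incl_def using carrier by (intro carrier_append_rows) auto
  with assms(2) have dim: "Sp_incl n k P \<in> carrier_mat n k" by simp
  have entry: "Sp_incl n k P $$ (i, j) = (if i < n - k then 0 else P $$ (i - (n - k), j))"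
    if "i < n" "j < k" for i j
    using that carrier assms(2) by (auto simp: Sp_incl_def append_rows_def)
  show "rows_norm_sq (n - k) k (column_frame (Sp_incl n k P)) = 0"
    by (simp add: rows_norm_sq_def entry)
  have "herm n (column_frame (Sp_incl n k P) a) (column_frame (Sp_incl n k P) b)
      = herm k (column_frame P a) (column_frame P b)" if "a < k" "b < k" for a b
  proof -
    have "herm n (column_frame (Sp_incl n k P) a) (column_frame (Sp_incl n k P) b)
        = (\<Sum>i\<in>{n - k..<n}. qcnj (P $$ (i - (n - k), a)) * P $$ (i - (n - k), b))"
      unfolding herm_def using that
      by (intro sum.mono_neutral_cong_right) (auto simp: entry)
    also have "\<dots> = herm k (column_frame P a) (column_frame P b)"
      unfolding herm_def using assms(2)
      by (intro sum.reindex_bij_witness[of _ "\<lambda>i. i + (n - k)" "\<lambda>i. i - (n - k)"]) auto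
    finally show ?thesis .
  qed
  with Sp_columns_orthonormal[OF P] dim show "Sp_incl n k P \<in> topspace (Stiefel n k)"
    by (simp add: topspace_Stiefel orthonormal_def)
qed

theorem proposition5p1:
  fixes k n :: nat
  assumes "0 < 2 * k" and "2 * k \<le> n"
  shows "LS_cat (Stiefel n k) (Sp_incl n k ` Sp k) = 0"
proof -
  let ?U = "{M \<in> topspace (Stiefel n k). rows_norm_sq (n - k) k (column_frame M) < 1}"
  have "Sp_incl n k ` Sp k \<subseteq> ?U"
    using Sp_incl_in_small_rows assms(2) by auto
  then have "\<exists>U :: nat \<Rightarrow> quat mat set.
      (\<forall>i\<le>0. openin (Stiefel n k) (U i) \<and> contractible_in (Stiefel n k) (U i)) \<and>
      Sp_incl n k ` Sp k \<subseteq> (\<Union>i\<le>0. U i)"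
    using openin_small_rows[of "n - k" n k] contractible_in_small_rows[OF assms(2)]
    by (intro exI[of _ "\<lambda>_. ?U"]) auto
  then have "LS_cat (Stiefel n k) (Sp_incl n k ` Sp k) \<le> enat 0"
    unfolding LS_cat_def by (intro Inf_lower) blast
  then show ?thesis by (simp flip: zero_enat_def)
qed

end
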